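(* Let $\mathcal{L}$ be the set of free states of a quantum resource theory on a finite-dimensional Hilbert space, let $\sigma_{\mathrm{in}}\in\mathcal{L}$ be a pure free state, and let $\mathcal{E}$ be a quantum channel whose output $\mathcal{E}(\sigma_{\mathrm{in}})\notin\mathcal{L}$ is a resource state. Let $\beta\in(0,\infty)$ be the inverse temperature of a thermal bath. Then for every real $\lambda>0$ with $\lambda\ge\beta^{-1}S(\mathcal{E}(\sigma_{\mathrm{in}}))/\mathcal{R}_{\mathcal{L}}(\mathcal{E}(\sigma_{\mathrm{in}}))$, $$\eta_{\mathrm{cost}}\big(\mathcal{E}(\sigma_{\mathrm{in}})\big)\le\frac{1}{\mathcal{R}_{\mathcal{L}}\big(\mathcal{E}(\sigma_{\mathrm{in}})\big)-\lambda^{-1}\beta^{-1}S\big(\mathcal{E}(\sigma_{\mathrm{in}})\big)}$$ (the right-hand side being read as $+\infty$ when its denominator is $0$). Moreover, if $S(\mathcal{E}(\sigma_{\mathrm{in}}))=0$, or at zero temperature, $$\eta_{\mathrm{cost}}\big(\mathcal{E}(\sigma_{\mathrm{in}})\big)\le\frac{1}{\mathcal{R}_{\mathcal{L}}\big(\mathcal{E}(\sigma_{\mathrm{in}})\big)}.$$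
   Context: All Hilbert spaces are finite-dimensional; a state is a positive semidefinite operator of unit trace; a quantum channel is a completely positive trace-preserving map (here from operators on the system to operators on the same system). $\mathcal{L}$ is a nonempty, closed, convex set of states, called free (resource-less) states; states not in $\mathcal{L}$ are called resource states. $\mathcal{M}_{\mathcal{L}}$ is the set of resource non-increasing (free) channels $\Omega$, i.e. those that map free states to free states. Generalized robustness: $\mathcal{R}_{\mathcal{L}}(\rho):=\min\{s\ge 0 : \text{there is a state }\gamma\text{ with }\frac{\rho+s\gamma}{1+s}\in\mathcal{L}\}$. One has $\mathcal{R}_{\mathcal{L}}(\rho)=0$ if and only if $\rho\in\mathcal{L}$. It has the dual form $\mathcal{R}_{\mathcal{L}}(\rho)=\max\{\mathrm{Tr}(Y\rho)-1 : Y\ge 0,\ \mathrm{Tr}(Y\sigma)\le 1\ \forall\sigma\in\mathcal{L}\}$ ($Y$ Hermitian). An optimal robustness witness for $\rho$ is an operator $Y^*\ge0$ attaining this maximum; one is assumed to exist for $\mathcal{E}(\sigma_{\mathrm{in}})$. (The parameter $\lambda$ is a multiplicative Hamiltonian parameter, corresponding to the Hamiltonian $H=\lambda Y^*$ with $Y^*$ an optimal witness for $\mathcal{E}(\sigma_{\mathrm{in}})$.) For a Hamiltonian (Hermitian operator) $H$: $S(\rho)=-\mathrm{Tr}(\rho\log\rho)$ is the von Neumann entropy (natural logarithm) and $F_H(\rho):=\mathrm{Tr}(H\rho)-\beta^{-1}S(\rho)$ is the free energy. The relative implementation cost is $$\eta_{\mathrm{cost}}\big(\mathcal{E}(\sigma_{\mathrm{in}})\big):=\min_{H\ge0}\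 \max_{\Omega\in\mathcal{M}_{\mathcal{L}}}\frac{F_H(\Omega(\sigma_{\mathrm{in}}))-F_H(\sigma_{\mathrm{in}})}{F_H(\mathcal{E}(\sigma_{\mathrm{in}}))-F_H(\sigma_{\mathrm{in}})},$$ the minimum being over all positive semidefinite Hamiltonians $H$ on the system for which the denominator is nonzero; minimum and maximum are read as infimum and supremum in the extended reals if not attained. Zero temperature means $\beta^{-1}=0$: the entropic terms vanish, so $F_H(\rho)=\mathrm{Tr}(H\rho)$, and $\eta_{\mathrm{cost}}$ is defined with these quantities. *)

theory Defs
  imports "HOL-Analysis.Analysis" "HOL-Library.Nonpos_Ints"
begin

text \<open>
  The finite-dimensional Hilbert space is \<open>complex ^ 'n\<close>; operators on it are matrices
  \<open>complex ^ 'n ^ 'n\<close>.  Closedness and (real) convexity of sets of operators are the library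
  notions for this type.
\<close>

definition cinner :: "complex ^ 'n \<Rightarrow> complex ^ 'n \<Rightarrow> complex" where
  "cinner u v = (\<Sum>i\<in>UNIV. cnj (u $ i) * v $ i)"

definition hermitian :: "complex ^ 'n ^ 'n \<Rightarrow> bool" where
  "hermitian A \<longleftrightarrow> map_matrix cnj (transpose A) = A"

definition ketbra :: "complex ^ 'n \<Rightarrow> complex ^ 'n ^ 'n" where
  "ketbra v = (\<chi> i j. v $ i * cnj (v $ j))"

text \<open>
  Over the complex numbers, a quadratic form with values in the nonnegative reals is
  automatically Hermitian, so this is positive semidefiniteness including self-adjointness
  (see \<open>psd_imp_hermitian\<close>).
\<close>

definition psd :: "complex ^ 'n ^ 'n \<Rightarrow> bool" where
  "psd A \<longleftrightarrow> (\<forall>v. cinner v (A *v v) \<in> \<real>\<^sub>\<ge>\<^sub>0)"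

definition is_state :: "complex ^ 'n ^ 'n \<Rightarrow> bool" where
  "is_state \<rho> \<longleftrightarrow> psd \<rho> \<and> trace \<rho> = 1"

definition pure_state :: "complex ^ 'n ^ 'n \<Rightarrow> bool" where
  "pure_state \<rho> \<longleftrightarrow> (\<exists>v. norm v = 1 \<and> \<rho> = ketbra v)"

text \<open>
  Positivity of an operator on the tensor product of \<open>\<complex>\<^sup>k\<close> with the system, given by its
  \<open>k \<times> k\<close> blocks \<open>X i j\<close> (\<open>i, j < k\<close>): the vector is given by its blocks \<open>v i\<close>.
  The ancilla is handled by blocks because its dimension ranges over all natural numbers.
\<close>

definition block_psd :: "nat \<Rightarrow> (nat \<Rightarrow> nat \<Rightarrow> complex ^ 'n ^ 'n) \<Rightarrow> bool" where
  "block_psd k X \<longleftrightarrow>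
     (\<forall>v :: nat \<Rightarrow> complex ^ 'n. (\<Sum>i<k. \<Sum>j<k. cinner (v i) (X i j *v v j)) \<in> \<real>\<^sub>\<ge>\<^sub>0)"

text \<open>The map \<open>id \<otimes> \<Phi>\<close> applies \<open>\<Phi>\<close> to every block.\<close>

definition completely_positive :: "(complex ^ 'n ^ 'n \<Rightarrow> complex ^ 'n ^ 'n) \<Rightarrow> bool" where
  "completely_positive \<Phi> \<longleftrightarrow>
     (\<forall>k X. block_psd k X \<longrightarrow> block_psd k (\<lambda>i j. \<Phi> (X i j)))"

definition complex_linear :: "(complex ^ 'n ^ 'n \<Rightarrow> complex ^ 'n ^ 'n) \<Rightarrow> bool" where
  "complex_linear \<Phi> \<longleftrightarrow>
     Vector_Spaces.linear (\<lambda>c. map_matrix ((*) c)) (\<lambda>c. map_matrix ((*) c)) \<Phi>"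

definition quantum_channel :: "(complex ^ 'n ^ 'n \<Rightarrow> complex ^ 'n ^ 'n) \<Rightarrow> bool" where
  "quantum_channel \<Phi> \<longleftrightarrow>
     complex_linear \<Phi> \<and> completely_positive \<Phi> \<and> (\<forall>X. trace (\<Phi> X) = trace X)"

definition free_states :: "(complex ^ 'n ^ 'n) set \<Rightarrow> bool" where
  "free_states L \<longleftrightarrow> L \<noteq> {} \<and> closed L \<and> convex L \<and> (\<forall>\<sigma>\<in>L. is_state \<sigma>)"

definition free_channels ::
    "(complex ^ 'n ^ 'n) set \<Rightarrow> (complex ^ 'n ^ 'n \<Rightarrow> complex ^ 'n ^ 'n) set" where
  "free_channels L = {\<Omega>. quantum_channel \<Omega> \<and> (\<forall>\<sigma>\<in>L. \<Omega> \<sigma> \<in> L)}"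

text \<open>
  Expectation value \<open>Tr (A \<rho>)\<close>; it is real for Hermitian \<open>A\<close> and \<open>\<rho>\<close>, the only case in
  which it is used.
\<close>

definition expect :: "complex ^ 'n ^ 'n \<Rightarrow> complex ^ 'n ^ 'n \<Rightarrow> real" where
  "expect A \<rho> = Re (trace (A ** \<rho>))"

text \<open>
  The infimum is taken in the extended reals: it is \<open>\<infinity>\<close> if no \<open>s\<close> is feasible, and
  otherwise it is the minimum, which exists because \<open>L\<close> is closed.
\<close>

definition robustness :: "(complex ^ 'n ^ 'n) set \<Rightarrow> complex ^ 'n ^ 'n \<Rightarrow> ereal" where
  "robustness L \<rho> =
     (INF s \<in> {s :: real. 0 \<le> s \<and> (\<exists>\<gamma>. is_state \<gamma> \<and> (1 / (1 + s)) *\<^sub>R (\<rho> + s *\<^sub>R \<gamma>) \<in> L)}. ereal s)"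

definition robustness_witness :: "(complex ^ 'n ^ 'n) set \<Rightarrow> complex ^ 'n ^ 'n \<Rightarrow> bool" where
  "robustness_witness L Y \<longleftrightarrow> psd Y \<and> (\<forall>\<sigma>\<in>L. expect Y \<sigma> \<le> 1)"

definition optimal_witness ::
    "(complex ^ 'n ^ 'n) set \<Rightarrow> complex ^ 'n ^ 'n \<Rightarrow> complex ^ 'n ^ 'n \<Rightarrow> bool" where
  "optimal_witness L \<rho> Y \<longleftrightarrow> is_arg_max (\<lambda>Y. expect Y \<rho> - 1) (robustness_witness L) Y"

definition real_spectrum :: "complex ^ 'n ^ 'n \<Rightarrow> real set" where
  "real_spectrum A = {l. \<exists>v. v \<noteq> 0 \<and> A *v v = complex_of_real l *s v}"

definition spectral_projection :: "complex ^ 'n ^ 'n \<Rightarrow> real \<Rightarrow> complex ^ 'n ^ 'n" where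
  "spectral_projection A l =
     (THE P. hermitian P \<and> P ** P = P \<and> range ((*v) P) = {v. A *v v = complex_of_real l *s v})"

text \<open>
  Logarithm of a positive semidefinite operator by the spectral decomposition.  The value of
  \<open>ln 0\<close> is immaterial in \<open>\<rho> log \<rho>\<close>, because \<open>\<rho>\<close> annihilates its own kernel projection;
  this is the convention \<open>0 log 0 = 0\<close>.
\<close>

definition op_log :: "complex ^ 'n ^ 'n \<Rightarrow> complex ^ 'n ^ 'n" where
  "op_log A = (\<Sum>l\<in>real_spectrum A. ln l *\<^sub>R spectral_projection A l)"

definition entropy :: "complex ^ 'n ^ 'n \<Rightarrow> real" where
  "entropy \<rho> = - Re (trace (\<rho> ** op_log \<rho>))"

text \<open>Here \<open>T\<close> is \<open>1/\<beta>\<close>, so that zero temperature is \<open>T = 0\<close>.\<close>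

definition free_energy :: "real \<Rightarrow> complex ^ 'n ^ 'n \<Rightarrow> complex ^ 'n ^ 'n \<Rightarrow> real" where
  "free_energy T H \<rho> = expect H \<rho> - T * entropy \<rho>"

definition eta_cost ::
    "(complex ^ 'n ^ 'n) set \<Rightarrow> real \<Rightarrow> (complex ^ 'n ^ 'n \<Rightarrow> complex ^ 'n ^ 'n) \<Rightarrow>
     complex ^ 'n ^ 'n \<Rightarrow> ereal" where
  "eta_cost L T \<E> \<sigma> =
     (INF H \<in> {H. psd H \<and> free_energy T H (\<E> \<sigma>) - free_energy T H \<sigma> \<noteq> 0}.
      SUP \<Omega> \<in> free_channels L.
        ereal ((free_energy T H (\<Omega> \<sigma>) - free_energy T H \<sigma>) /
               (free_energy T H (\<E> \<sigma>) - free_energy T H \<sigma>)))"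

lemma cinner_axis: "cinner (axis i a) (A *v axis k b) = cnj a * A $ i $ k * b"
proof -
  have l: "(\<Sum>j\<in>UNIV. cnj (axis i a $ j) * f j) = cnj a * f i" for f
  proof -
    have "(\<Sum>j\<in>UNIV. cnj (axis i a $ j) * f j) = (\<Sum>j\<in>UNIV. if j = i then cnj a * f i else 0)"
      by (rule sum.cong) (auto simp: axis_def)
    then show ?thesis by simp
  qed
  have r: "(\<Sum>j\<in>UNIV. f j * axis k b $ j) = f k * b" for f
  proof -
    have "(\<Sum>j\<in>UNIV. f j * axis k b $ j) = (\<Sum>j\<in>UNIV. if j = k then f k * b else 0)"
      by (rule sum.cong) (auto simp: axis_def)
    then show ?thesis by simp
  qed
  show ?thesis
    by (simp add: cinner_def matrix_vector_mult_def l r)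
qed

lemma psd_imp_hermitian:
  assumes "psd A"
  shows "hermitian A"
proof -
  have quad: "Im (cinner v (A *v v)) = 0" for v
    using assms by (simp add: psd_def complex_nonneg_Reals_iff)
  have add_left: "cinner (u + u') w = cinner u w + cinner u' w" for u u' w :: "complex ^ 'n"
    by (simp add: cinner_def ring_distribs sum.distrib)
  have add_right: "cinner w (u + u') = cinner w u + cinner w u'" for u u' w :: "complex ^ 'n"
    by (simp add: cinner_def ring_distribs sum.distrib)
  have two: "Im (cnj a * A $ i $ i * a + cnj a * A $ i $ k * b +
                 (cnj b * A $ k $ i * a + cnj b * A $ k $ k * b)) = 0" for a b i k
    using quad [of "axis i a + axis k b"]
    by (simp only: matrix_vector_right_distrib add_left add_right cinner_axis add.assoc add.commute add.left_commute)
  have "cnj (A $ i $ k) = A $ k $ i" for i k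
  proof -
    have d: "Im (A $ i $ i) = 0" "Im (A $ k $ k) = 0"
      using two [of 1 i i 0] two [of 1 k k 0] by simp_all
    show ?thesis
      using two [of 1 i k 1] two [of 1 i k \<i>] d by (simp add: complex_eq_iff)
  qed
  then show ?thesis
    by (simp add: hermitian_def vec_eq_iff transpose_def)
qed

end

theory Submission
  imports Defs
begin

text \<open>
  The Hamiltonian \<open>\<lambda>Y\<close> with \<open>Y\<close> an optimal witness achieves the bound: every free channel keeps
  \<open>Tr(Y \<Omega>(\<sigma>)) \<le> 1\<close>, entropies are nonnegative and the entropy of the pure \<open>\<sigma>\<close> vanishes, so with
  \<open>x = 1 - Tr(Y \<sigma>) \<in> [0, 1]\<close> and \<open>d = R - T S / \<lambda>\<close> each quotient is at most
  \<open>x / (x + d) \<le> 1 / d\<close>.  Only the inequality \<open>R \<le> Tr(Y \<E>(\<sigma>)) - 1\<close> of the dual form is needed.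
  It holds because, for each \<open>s\<close> infeasible in the primal problem, a hyperplane strictly separates
  the compact set \<open>(1 + s) L\<close> from the closed set \<open>\<E>(\<sigma>) + {P. P \<ge> 0}\<close>, and its normal, rescaled,
  is a witness with value above \<open>s\<close>.
\<close>

subsection \<open>Sesquilinear form, trace and Hermitian matrices\<close>

lemma cinner_commute: "cinner u v = cnj (cinner v u)"
  by (simp add: cinner_def mult.commute)

lemma cinner_add_left: "cinner (u + u') v = cinner u v + cinner u' v"
  by (simp add: cinner_def ring_distribs sum.distrib)

lemma cinner_add_right: "cinner u (v + v') = cinner u v + cinner u v'"
  by (simp add: cinner_def ring_distribs sum.distrib)

lemma cinner_diff_right: "cinner u (v - v') = cinner u v - cinner u v'"
  by (simp add: cinner_def ring_distribs sum_subtractf)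

lemma cinner_scale_left: "cinner (c *s u) v = cnj c * cinner u v"
  by (simp add: cinner_def sum_distrib_left mult.assoc)

lemma cinner_scale_right: "cinner u (c *s v) = c * cinner u v"
  by (simp add: cinner_def sum_distrib_left mult.left_commute)

text \<open>Links the complex form to the real Euclidean inner product, so that real orthogonality
  and norms can be used for complex vectors.\<close>

lemma Re_cinner: "Re (cinner u v) = inner u v"
  by (simp add: cinner_def inner_vec_def inner_complex_def)

lemma cinner_self: "cinner v v = complex_of_real ((norm v)\<^sup>2)"
proof -
  have "Im (cinner v v) = 0"
    by (simp add: cinner_def mult.commute)
  then show ?thesis
    by (simp add: complex_eq_iff Re_cinner dot_square_norm)
qed

lemma cinner_axis_left: "cinner (axis i 1) v = v $ i"
proof -
  have "cinner (axis i 1) v = (\<Sum>j\<in>UNIV. if j = i then v $ i else 0)"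
    unfolding cinner_def by (rule sum.cong) (auto simp: axis_def)
  then show ?thesis by simp
qed

lemma hermitian_iff_component: "hermitian A \<longleftrightarrow> (\<forall>i j. cnj (A $ i $ j) = A $ j $ i)"
  by (auto simp: hermitian_def vec_eq_iff transpose_def)

lemma hermitian_iff_selfadjoint:
  "hermitian A \<longleftrightarrow> (\<forall>u v. cinner u (A *v v) = cinner (A *v u) v)"
proof
  assume h: "hermitian A"
  show "\<forall>u v. cinner u (A *v v) = cinner (A *v u) v"
  proof (intro allI)
    fix u v
    have "cinner u (A *v v) = (\<Sum>i\<in>UNIV. \<Sum>j\<in>UNIV. cnj (u $ i) * (A $ i $ j * v $ j))"
      by (simp add: cinner_def matrix_vector_mult_def sum_distrib_left)
    also have "\<dots> = (\<Sum>j\<in>UNIV. \<Sum>i\<in>UNIV. cnj (A $ j $ i * u $ i) * v $ j)"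
      using h by (subst sum.swap) (simp add: hermitian_iff_component mult_ac)
    also have "\<dots> = cinner (A *v u) v"
      by (simp add: cinner_def matrix_vector_mult_def sum_distrib_right)
    finally show "cinner u (A *v v) = cinner (A *v u) v" .
  qed
next
  assume a: "\<forall>u v. cinner u (A *v v) = cinner (A *v u) v"
  have "cnj (A $ i $ j) = A $ j $ i" for i j
    using a [rule_format, of "axis i 1" "axis j 1"]
      cinner_axis [of i 1 A j 1] cinner_axis [of j 1 A i 1]
      cinner_commute [of "A *v axis i 1" "axis j 1"]
    by simp
  then show "hermitian A" by (simp add: hermitian_iff_component)
qed

text \<open>The real inner product on matrices is the real part of the Hilbert-Schmidt product. This
  lets the normal of a separating hyperplane be read as an observable.\<close>

lemma expect_eq_inner: "hermitian A \<Longrightarrow> expect A X = inner A X"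
proof -
  assume h: "hermitian A"
  have "expect A X = (\<Sum>i\<in>UNIV. \<Sum>j\<in>UNIV. Re (A $ i $ j * X $ j $ i))"
    by (simp add: expect_def trace_def matrix_matrix_mult_def)
  also have "\<dots> = (\<Sum>j\<in>UNIV. \<Sum>i\<in>UNIV. Re (cnj (A $ j $ i) * X $ j $ i))"
    using h by (subst sum.swap) (simp only: hermitian_iff_component)
  also have "\<dots> = inner A X"
    by (simp add: inner_vec_def inner_complex_def)
  finally show ?thesis .
qed

lemma expect_ketbra: "expect A (ketbra v) = Re (cinner v (A *v v))"
  by (simp add: expect_def trace_def matrix_matrix_mult_def ketbra_def cinner_def
      matrix_vector_mult_def sum_distrib_left mult_ac)

lemma expect_scaleR_left: "expect (c *\<^sub>R A) X = c * expect A X"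
  by (simp add: expect_def trace_def matrix_matrix_mult_def sum_distrib_left)

lemma cinner_scaleR_matrix: "cinner v ((c *\<^sub>R A) *v v) = c *\<^sub>R cinner v (A *v v)"
  by (simp add: cinner_def matrix_vector_mult_def
      scaleR_conv_of_real [where 'a = complex] sum_distrib_left mult_ac)

subsection \<open>Positive semidefinite matrices and states\<close>

lemma psd_scaleR:
  assumes "psd A" "0 \<le> c"
  shows "psd (c *\<^sub>R A)"
  using assms by (auto simp: psd_def cinner_scaleR_matrix complex_nonneg_Reals_iff)

lemma psd_add:
  assumes "psd A" "psd B"
  shows "psd (A + B)"
  using assms
  by (auto simp: psd_def matrix_vector_mult_add_rdistrib cinner_add_right complex_nonneg_Reals_iff)

lemma psd_Re_nonneg: "psd A \<Longrightarrow> 0 \<le> Re (cinner v (A *v v))"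
  by (simp add: psd_def complex_nonneg_Reals_iff)

lemma psd_iff_hermitian: "psd A \<longleftrightarrow> hermitian A \<and> (\<forall>v. 0 \<le> Re (cinner v (A *v v)))"
proof
  assume "psd A"
  then show "hermitian A \<and> (\<forall>v. 0 \<le> Re (cinner v (A *v v)))"
    by (simp add: psd_imp_hermitian psd_Re_nonneg)
next
  assume a: "hermitian A \<and> (\<forall>v. 0 \<le> Re (cinner v (A *v v)))"
  have "Im (cinner v (A *v v)) = 0" for v
  proof -
    have "cinner v (A *v v) = cnj (cinner v (A *v v))"
      using a cinner_commute [of v "A *v v"] by (simp add: hermitian_iff_selfadjoint)
    then show ?thesis by (simp add: complex_eq_iff)
  qed
  with a show "psd A" by (simp add: psd_def complex_nonneg_Reals_iff)
qed

lemma psd_ketbra: "psd (ketbra v)"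
proof -
  have "cinner u (ketbra v *v u) = cinner v u * cnj (cinner v u)" for u
    by (simp add: cinner_def ketbra_def matrix_vector_mult_def sum_distrib_left
        sum_distrib_right mult_ac)
  then show ?thesis
    by (simp add: psd_def complex_nonneg_Reals_iff)
qed

lemma closed_psd: "closed {A :: complex ^ 'n ^ 'n. psd A}"
proof -
  have "closed {A :: complex ^ 'n ^ 'n. cinner v (A *v v) \<in> \<real>\<^sub>\<ge>\<^sub>0}" for v
    unfolding cinner_def matrix_vector_mult_def complex_nonneg_Reals_iff
    by (intro closed_Collect_conj closed_Collect_le closed_Collect_eq) (auto intro!: continuous_intros)
  then show ?thesis
    unfolding psd_def by (intro closed_Collect_all)
qed

lemma convex_psd: "convex {A. psd A}"
  by (auto simp: convex_def psd_add psd_scaleR)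

lemma psd_diag: "psd A \<Longrightarrow> 0 \<le> Re (A $ i $ i) \<and> Im (A $ i $ i) = 0"
  using cinner_axis [of i 1 A i 1] unfolding psd_def complex_nonneg_Reals_iff
  by (metis complex_cnj_one mult_1 mult_1_right)

lemma psd_diag_le_trace: "psd A \<Longrightarrow> Re (A $ i $ i) \<le> Re (trace A)"
  by (auto simp: trace_def psd_diag intro!: member_le_sum)

text \<open>Testing the form on \<open>axis i 1 + axis k b\<close>, with the phase \<open>b\<close>
  chosen so that \<open>A $ i $ k * b\<close> is minus the modulus of that entry, bounds twice the
  modulus by the sum of two diagonal entries. Each of these is at most the trace.\<close>

lemma psd_entry_le_trace:
  fixes A :: "complex ^ 'n ^ 'n"
  assumes "psd A"
  shows "norm (A $ i $ k) \<le> Re (trace A)"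
proof (cases "A $ i $ k = 0")
  case True
  then show ?thesis
    using psd_diag [OF assms, of i] psd_diag_le_trace [OF assms, of i] by simp
next
  case False
  define b where "b = - cnj (sgn (A $ i $ k))"
  have bA: "A $ i $ k * b = - norm (A $ i $ k)"
    using False by (simp add: b_def sgn_eq complex_norm_square [symmetric] power2_eq_square)
  have nb: "cnj b * b = 1"
    using False complex_norm_square[of b] by (simp add: b_def norm_sgn mult.commute)
  have ki: "A $ k $ i = cnj (A $ i $ k)"
    using psd_imp_hermitian [OF assms] by (simp add: hermitian_iff_component)
  let ?w = "axis i 1 + axis k b :: complex ^ 'n"
  have "cinner ?w (A *v ?w) =
      A $ i $ i + A $ i $ k * b + (cnj (A $ i $ k * b) + cnj b * A $ k $ k * b)"
    by (simp add: matrix_vector_right_distrib cinner_add_left cinner_add_right cinner_axis ki)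
  also have "cnj b * A $ k $ k * b = A $ k $ k"
    using nb by (metis mult.assoc mult.commute mult_1)
  finally have "0 \<le> Re (A $ i $ i) + Re (A $ k $ k) - 2 * norm (A $ i $ k)"
    using psd_Re_nonneg [OF assms, of ?w] by (simp add: bA)
  then show ?thesis
    using psd_diag_le_trace [OF assms, of i] psd_diag_le_trace [OF assms, of k] by simp
qed

lemma psd_trace_zero: "psd A \<Longrightarrow> trace A = 0 \<Longrightarrow> A = 0"
  using psd_entry_le_trace [of A] by (simp add: vec_eq_iff)

lemma bounded_states: "bounded {\<rho> :: complex ^ 'n ^ 'n. is_state \<rho>}"
proof (rule boundedI)
  fix \<rho> :: "complex ^ 'n ^ 'n"
  assume "\<rho> \<in> {\<rho>. is_state \<rho>}"
  then have e: "norm (\<rho> $ i $ j) \<le> 1" for i j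
    using psd_entry_le_trace [of \<rho> i j] by (simp add: is_state_def)
  have row: "norm (\<rho> $ i) \<le> (\<Sum>j\<in>(UNIV::'n set). 1)" for i
    unfolding norm_vec_def [of "\<rho> $ i"]
    by (rule order_trans [OF L2_set_le_sum]) (simp, intro sum_mono e)
  show "norm \<rho> \<le> (\<Sum>i\<in>(UNIV::'n set). \<Sum>j\<in>(UNIV::'n set). 1)"
    unfolding norm_vec_def [of \<rho>]
    by (rule order_trans [OF L2_set_le_sum]) (simp, intro sum_mono row)
qed

text \<open>The vector \<open>e\<^sub>i - (cnj v\<^sub>i / \<parallel>v\<parallel>\<^sup>2) v\<close> shows \<open>l |v\<^sub>i|\<^sup>2 \<le> \<parallel>v\<parallel>\<^sup>2 A\<^sub>i\<^sub>i\<close>.\<close>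

lemma psd_spectrum_bounds:
  assumes "psd A" "l \<in> real_spectrum A"
  shows "0 \<le> l" "l \<le> Re (trace A)"
proof -
  from assms(2) obtain v where v: "v \<noteq> 0" "A *v v = complex_of_real l *s v"
    by (auto simp: real_spectrum_def)
  define N where "N = (norm v)\<^sup>2"
  have N: "0 < N" using v by (simp add: N_def)
  have vv: "cinner v v = complex_of_real N" by (simp add: cinner_self N_def)
  have "0 \<le> l * N"
    using psd_Re_nonneg [OF assms(1), of v] by (simp add: v cinner_scale_right vv)
  then show "0 \<le> l" using N by (simp add: zero_le_mult_iff)
  have *: "l * (norm (v $ i))\<^sup>2 / N \<le> Re (A $ i $ i)" for i
  proof -
    define z where "z = - cnj (v $ i) / complex_of_real N"
    let ?w = "axis i 1 + z *s v"
    have iv: "cinner (axis i 1) (A *v v) = l * v $ i"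
      by (simp add: v cinner_scale_right cinner_axis_left)
    have vi: "cinner v (A *v axis i 1) = l * cnj (v $ i)"
      using psd_imp_hermitian [OF assms(1)] cinner_commute [of v "axis i 1"]
      by (simp add: hermitian_iff_selfadjoint v cinner_scale_left cinner_axis_left)
    have vAv: "cinner v (A *v v) = l * N"
      by (simp add: v cinner_scale_right vv)
    have zi: "z * v $ i = - complex_of_real ((norm (v $ i))\<^sup>2 / N)"
      by (simp add: z_def complex_norm_square [symmetric] mult.commute)
    have zz: "cnj z * z * N = complex_of_real ((norm (v $ i))\<^sup>2 / N)"
      using N by (simp add: z_def complex_norm_square [symmetric] mult.commute)
    have "cinner ?w (A *v ?w) = A $ i $ i + l * (z * v $ i) + (l * cnj (z * v $ i) + l * (cnj z * z * N))"
      by (simp add: matrix_vector_right_distrib cinner_add_left cinner_add_right cinner_axis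
          vector_scalar_commute cinner_scale_left cinner_scale_right iv vi vAv algebra_simps)
    then show ?thesis
      using psd_Re_nonneg [OF assms(1), of ?w] unfolding zi zz by simp
  qed
  have "(norm v)\<^sup>2 = (\<Sum>i\<in>UNIV. (norm (v $ i))\<^sup>2)"
    by (simp add: norm_vec_def L2_set_def sum_nonneg)
  \<comment> \<open>The weights \<open>(norm (v $ i))\<^sup>2 / N\<close> sum to 1, so adding up the
    bounds \<open>*\<close> compares \<open>l\<close> with the trace.\<close>
  then have "l = (\<Sum>i\<in>UNIV. l * (norm (v $ i))\<^sup>2 / N)"
    using N by (simp add: N_def sum_distrib_left [symmetric] sum_divide_distrib [symmetric])
  also have "\<dots> \<le> Re (trace A)"
    unfolding trace_def Re_sum by (intro sum_mono *)
  finally show "l \<le> Re (trace A)" .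
qed

subsection \<open>Spectral projections and entropy\<close>

text \<open>A complex subspace is also a real one, so the real orthogonal decomposition applies.
  Invariance of \<open>S\<close> under multiplication by \<i> upgrades real orthogonality to complex
  orthogonality.\<close>

lemma ex_orthogonal_projection:
  fixes S :: "(complex ^ 'n) set"
  assumes S: "vec.subspace S"
  shows "\<exists>P. hermitian P \<and> P ** P = P \<and> range ((*v) P) = S"
proof -
  have sc: "c *\<^sub>R x = complex_of_real c *s x" for c and x :: "complex ^ 'n"
    by (simp only: vec_eq_iff vector_scaleR_component vector_smult_component) (simp add: scaleR_conv_of_real)
  have S0: "0 \<in> S" and Sa: "\<And>x y. x \<in> S \<Longrightarrow> y \<in> S \<Longrightarrow> x + y \<in> S"
    and Sc: "\<And>c x. x \<in> S \<Longrightarrow> c *s x \<in> S"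
    using S by (auto simp: vec.subspace_def)
  have "subspace S"
    by (auto simp: subspace_def S0 Sa Sc sc)
  then have span: "span S = S" by (rule span_eq_iff [THEN iffD2])
  have ex: "\<exists>y. y \<in> S \<and> (\<forall>w\<in>S. cinner w (x - y) = 0)" for x
  proof -
    obtain y z where yz: "y \<in> span S" "\<And>w. w \<in> span S \<Longrightarrow> orthogonal z w" "x = y + z"
      using orthogonal_subspace_decomp_exists [of S x] by blast
    have "cinner w z = 0" if w: "w \<in> S" for w
    proof -
      \<comment> \<open>The second real part, taken at \<open>\<i> *s w\<close>, is the imaginary
        part of \<open>cinner w z\<close>.\<close>
      have "Re (cinner w z) = 0" "Re (cinner (\<i> *s w) z) = 0"
        using yz(2) [of w] yz(2) [of "\<i> *s w"] w Sc [OF w]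
        by (simp_all add: span Re_cinner orthogonal_def inner_commute)
      then show ?thesis by (simp add: cinner_scale_left complex_eq_iff)
    qed
    with yz show ?thesis by (auto simp: span)
  qed
  then obtain p where p: "\<And>x. p x \<in> S" "\<And>x w. w \<in> S \<Longrightarrow> cinner w (x - p x) = 0"
    by metis
  \<comment> \<open>Membership in \<open>S\<close> and orthogonality of the remainder determine
    \<open>p x\<close>. Linearity and \<open>fixp\<close> follow by checking these two
    properties.\<close>
  have uniq: "p x = y" if "y \<in> S" "\<And>w. w \<in> S \<Longrightarrow> cinner w (x - y) = 0" for x y
  proof -
    have d: "p x - y \<in> S"
      using Sa [OF p(1) Sc [OF that(1), of "-1"], of x] by simp
    have "cinner (p x - y) (p x - y) = cinner (p x - y) (x - y) - cinner (p x - y) (x - p x)"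
      by (simp add: cinner_diff_right)
    also have "\<dots> = 0" using p(2) [OF d] that(2) [OF d] by simp
    finally show ?thesis by (simp add: cinner_self)
  qed
  have lin: "Vector_Spaces.linear (*s) (*s) p"
  proof (unfold_locales)
    fix x y c
    show "p (x + y) = p x + p y"
    proof (rule uniq)
      fix w assume w: "w \<in> S"
      have "x + y - (p x + p y) = (x - p x) + (y - p y)" by simp
      then show "cinner w (x + y - (p x + p y)) = 0"
        by (simp only: cinner_add_right p(2) [OF w]) simp
    qed (simp add: Sa p)
    show "p (c *s x) = c *s p x"
    proof (rule uniq)
      fix w assume w: "w \<in> S"
      show "cinner w (c *s x - c *s p x) = 0"
        using p(2) [OF w, of x] by (simp add: cinner_diff_right cinner_scale_right)
    qed (simp add: Sc p)
  qed
  have mp: "matrix p *v x = p x" for x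
    using matrix_works [OF lin] .
  have fixp: "p x = x" if "x \<in> S" for x
    using that by (intro uniq) (auto simp: cinner_def)
  have "cinner u (p v) = cinner (p u) v" for u v
  proof -
    have *: "cinner (p a) b = cinner (p a) (p b)" for a b
      using p(2) [OF p(1) [of a], of b] by (simp add: cinner_diff_right)
    have "cinner u (p v) = cnj (cinner (p v) u)" by (rule cinner_commute)
    also have "\<dots> = cinner (p u) (p v)" using * [of v u] cinner_commute [of "p u" "p v"] by simp
    finally show ?thesis using * [of u v] by simp
  qed
  then have "hermitian (matrix p)" by (simp add: hermitian_iff_selfadjoint mp)
  moreover have "matrix p ** matrix p = matrix p"
    by (simp add: matrix_eq matrix_vector_mul_assoc [symmetric] mp fixp p(1))
  moreover have "range ((*v) (matrix p)) = S"
    using p(1) fixp by (auto simp: mp image_iff) (metis)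
  ultimately show ?thesis by blast
qed

text \<open>Each projection fixes the common range, so \<open>P = Q ** P\<close> and
  \<open>Q = P ** Q\<close>; taking the adjoint of the first equation gives
  \<open>P = P ** Q = Q\<close>.\<close>

lemma hermitian_projection_unique:
  assumes P: "hermitian P" "P ** P = P" and Q: "hermitian Q" "Q ** Q = Q"
    and r: "range ((*v) P) = range ((*v) Q)"
  shows "P = Q"
proof -
  have fixes_range: "A *v (B *v x) = B *v x"
    if AB: "A ** A = A" "range ((*v) A) = range ((*v) B)" for A B :: "complex ^ 'n ^ 'n" and x
  proof -
    obtain y where "B *v x = A *v y" using AB(2) by blast
    then show ?thesis using AB(1) by (simp add: matrix_vector_mul_assoc)
  qed
  have "cinner u (P *v v) = cinner u (Q *v v)" for u v
  proof -
    have "cinner u (P *v v) = cinner u (Q *v (P *v v))"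
      using fixes_range [OF Q(2) r [symmetric]] by simp
    also have "\<dots> = cinner (P *v (Q *v u)) v"
      using P(1) Q(1) by (simp add: hermitian_iff_selfadjoint)
    also have "\<dots> = cinner u (Q *v v)"
      using fixes_range [OF P(2) r] Q(1) by (simp add: hermitian_iff_selfadjoint)
    finally show ?thesis .
  qed
  then have "P *v v = Q *v v" for v
    using cinner_axis_left by (metis vec_eq_iff)
  then show ?thesis by (simp add: matrix_eq)
qed

text \<open>Justifies the definite description for every matrix: an eigenspace is always a subspace,
  and it is the zero subspace when \<open>l\<close> is not an eigenvalue.\<close>

lemma spectral_projection:
  fixes A :: "complex ^ 'n ^ 'n" and l :: real
  defines "P \<equiv> spectral_projection A l"
  shows "hermitian P" "P ** P = P" "range ((*v) P) = {v. A *v v = complex_of_real l *s v}"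
proof -
  have "vec.subspace {v. A *v v = complex_of_real l *s v}"
    by (auto simp: vec.subspace_def matrix_vector_right_distrib vector_add_ldistrib vector_scalar_commute
        vec_eq_iff ring_distribs mult_ac)
  then have "\<exists>!P. hermitian P \<and> P ** P = P \<and> range ((*v) P) = {v. A *v v = complex_of_real l *s v}"
    using ex_orthogonal_projection hermitian_projection_unique by (metis (no_types, lifting))
  from theI' [OF this] show "hermitian P" "P ** P = P"
    "range ((*v) P) = {v. A *v v = complex_of_real l *s v}"
    by (auto simp: P_def spectral_projection_def)
qed

lemma trace_mult_spectral_projection:
  "trace (A ** spectral_projection A l) = l * trace (spectral_projection A l)"
proof -
  let ?P = "spectral_projection A l"
  have "A *v (?P *v x) = l *s (?P *v x)" for x
    using spectral_projection(3) [of A l] by blast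
  then have "A ** ?P = map_matrix ((*) l) ?P"
    by (simp add: matrix_eq matrix_vector_mul_assoc [symmetric])
       (simp add: vec_eq_iff matrix_vector_mult_def sum_distrib_left mult.assoc)
  then show ?thesis by (simp add: trace_def sum_distrib_left)
qed

lemma trace_hermitian_projection_nonneg:
  assumes "hermitian P" "P ** P = P"
  shows "0 \<le> Re (trace P)"
proof -
  have "trace P = trace (P ** P)" by (simp add: assms(2))
  then have "Re (trace P) = inner P P"
    using expect_eq_inner [OF assms(1), of P] by (simp add: expect_def)
  then show ?thesis by simp
qed

text \<open>On the range of its spectral projection \<open>A\<close> acts as the scalar
  \<open>l\<close>, so each trace reduces to \<open>l\<close> times the trace of the projection. No
  diagonalization of \<open>A\<close> is involved.\<close>

lemma entropy_eq_sum:
  fixes A :: "complex ^ 'n ^ 'n"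
  shows "entropy A = (\<Sum>l\<in>real_spectrum A. - (l * ln l) * Re (trace (spectral_projection A l)))"
proof -
  \<comment> \<open>The induction includes infinite \<open>I\<close>, where both sums are 0 by
    convention, so finiteness of the spectrum never has to be shown.\<close>
  have tr: "trace (A ** (\<Sum>l\<in>I. f l *\<^sub>R B l)) = (\<Sum>l\<in>I. f l *\<^sub>R trace (A ** B l))"
    for I :: "real set" and f and B :: "real \<Rightarrow> complex ^ 'n ^ 'n"
    by (induction I rule: infinite_finite_induct)
       (simp_all add: matrix_add_ldistrib trace_add trace_0 matrix_scalar_ac
         scaleR_sum_right trace_def matrix_matrix_mult_def sum_distrib_left ring_distribs sum.distrib)
  show ?thesis
    unfolding entropy_def op_log_def tr trace_mult_spectral_projection
    by (simp add: sum_negf [symmetric] mult_ac)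
qed

lemma entropy_nonneg:
  assumes "is_state \<rho>"
  shows "0 \<le> entropy \<rho>"
  unfolding entropy_eq_sum
proof (rule sum_nonneg)
  fix l assume "l \<in> real_spectrum \<rho>"
  then have l: "0 \<le> l" "l \<le> 1"
    using psd_spectrum_bounds [of \<rho> l] assms by (auto simp: is_state_def)
  then have "0 \<le> - (l * ln l)"
    by (cases "l = 0") (auto simp: mult_le_0_iff)
  then show "0 \<le> - (l * ln l) * Re (trace (spectral_projection \<rho> l))"
    using trace_hermitian_projection_nonneg spectral_projection(1,2) by (intro mult_nonneg_nonneg) blast+
qed

lemma entropy_pure:
  assumes "pure_state \<rho>"
  shows "entropy \<rho> = 0"
proof -
  from assms obtain v where v: "norm v = 1" "\<rho> = ketbra v" by (auto simp: pure_state_def)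
  have app: "\<rho> *v w = cinner v w *s v" for w
    by (simp add: v ketbra_def matrix_vector_mult_def cinner_def vec_eq_iff sum_distrib_left
        sum_distrib_right mult_ac)
  have "l = 0 \<or> l = 1" if "l \<in> real_spectrum \<rho>" for l
  proof -
    from that obtain w where w: "w \<noteq> 0" "cinner v w *s v = complex_of_real l *s w"
      by (auto simp: real_spectrum_def app)
    \<comment> \<open>Pairing the eigenvector equation with the unit vector \<open>v\<close> leaves
      only \<open>l = 1\<close> or \<open>w\<close> orthogonal to \<open>v\<close>; in the latter
      case \<open>l = 0\<close>. Both values make \<open>l * ln l\<close> vanish.\<close>
    have "cinner v (cinner v w *s v) = cinner v (complex_of_real l *s w)"
      by (simp add: w)
    then have "cinner v w = l * cinner v w"
      by (simp add: cinner_scale_right cinner_self v)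
    then have "l = 1 \<or> cinner v w = 0" by auto
    moreover have "l = 0" if "cinner v w = 0"
      using w that by (auto simp: vec_eq_iff)
    ultimately show ?thesis by blast
  qed
  then show ?thesis
    unfolding entropy_eq_sum by (intro sum.neutral) force
qed

subsection \<open>Strong duality for the robustness\<close>

lemma separating_witness:
  fixes L :: "(complex ^ 'n ^ 'n) set"
  assumes L: "free_states L" and \<rho>: "is_state \<rho>" and s: "0 \<le> s"
    and infeasible: "\<nexists>\<gamma>. is_state \<gamma> \<and> (1 / (1 + s)) *\<^sub>R (\<rho> + s *\<^sub>R \<gamma>) \<in> L"
  shows "\<exists>Y. robustness_witness L Y \<and> s < expect Y \<rho> - 1"
proof -
  have L': "L \<noteq> {}" "closed L" "convex L" and Lst: "\<And>\<tau>. \<tau> \<in> L \<Longrightarrow> is_state \<tau>"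
    using L by (auto simp: free_states_def)
  have "compact L"
    using L' Lst bounded_subset [OF bounded_states] by (auto simp: compact_eq_bounded_closed)
  let ?S = "(*\<^sub>R) (1 + s) ` L" and ?T = "(+) \<rho> ` {P. psd P}"
  have "?S \<inter> ?T = {}"
  proof (rule ccontr)
    assume "?S \<inter> ?T \<noteq> {}"
    then obtain \<tau> P where tP: "\<tau> \<in> L" "psd P" "(1 + s) *\<^sub>R \<tau> = \<rho> + P" by blast
    \<comment> \<open>Comparing traces at a common point gives \<open>P\<close> trace
      \<open>s\<close>. Hence \<open>P\<close> divided by \<open>s\<close> would be a feasible
      \<gamma>; if \<open>s = 0\<close> then \<open>P = 0\<close>, and \<rho> itself serves as
      \<gamma>.\<close>
    then have "trace ((1 + s) *\<^sub>R \<tau>) = trace \<rho> + trace P" by (simp add: trace_add)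
    moreover have scale: "trace (c *\<^sub>R A) = c *\<^sub>R trace A" for c and A :: "complex ^ 'n ^ 'n"
      by (simp add: trace_def scaleR_sum_right)
    ultimately have trP: "trace P = complex_of_real s"
      using \<rho> Lst [OF tP(1)] by (simp add: is_state_def scaleR_conv_of_real [where 'a = complex])
    have \<tau>: "\<tau> = (1 / (1 + s)) *\<^sub>R (\<rho> + P)"
      using s by (simp add: tP(3) [symmetric])
    show False
    proof (cases "s = 0")
      case True
      then have "P = 0" using psd_trace_zero tP(2) trP by simp
      then show False using infeasible tP(1) \<tau> \<rho> True by auto
    next
      case False
      then have "is_state ((1 / s) *\<^sub>R P)"
        using s tP(2) by (simp add: is_state_def psd_scaleR scale trP scaleR_conv_of_real [where 'a = complex])
      moreover have "s *\<^sub>R ((1 / s) *\<^sub>R P) = P" using False by simp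
      ultimately show False using infeasible tP(1) \<tau> by metis
    qed
  qed
  moreover have "compact ?S" "convex ?S" "?S \<noteq> {}"
    using \<open>compact L\<close> L' by (auto intro: compact_scaling convex_scaling)
  moreover have "closed ?T" "convex ?T"
    using closed_psd convex_psd by (auto intro: closed_translation convex_translation)
  ultimately obtain Z b where Zb: "\<And>X. X \<in> ?S \<Longrightarrow> inner Z X < b" "\<And>X. X \<in> ?T \<Longrightarrow> b < inner Z X"
    using separating_hyperplane_compact_closed [of ?S ?T] by metis
  have ZP: "0 \<le> inner Z P" if P: "psd P" for P
  proof (rule ccontr)
    assume neg: "\<not> 0 \<le> inner Z P"
    \<comment> \<open>The half-space contains the whole ray from \<rho> in direction
      \<open>P\<close>. If \<open>inner Z P\<close> were negative, the point at this
      \<open>t\<close> would already have left it; the maximum with 0 keeps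
      \<open>t *\<^sub>R P\<close> positive.\<close>
    define t where "t = max 0 ((b - inner Z \<rho>) / inner Z P)"
    have "b < inner Z (\<rho> + t *\<^sub>R P)"
      by (rule Zb(2)) (use P in \<open>auto simp: t_def psd_scaleR\<close>)
    moreover have "t * inner Z P \<le> b - inner Z \<rho>"
      using neg by (simp add: t_def max_def divide_simps not_le split: if_splits)
    ultimately show False by (simp add: inner_add_right)
  qed
  \<comment> \<open>The normal \<open>Z\<close> need not be Hermitian. Its Hermitian part has the
    same pairing with every Hermitian matrix; positivity is then tested on the rank-one matrices
    \<open>ketbra v\<close>.\<close>
  define Y where "Y = (1/2) *\<^sub>R (Z + map_matrix cnj (transpose Z))"
  have herm: "hermitian Y"
    by (simp add: Y_def hermitian_iff_component transpose_def add.commute)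
  have YZ: "expect Y X = inner Z X" if X: "hermitian X" for X
  proof -
    have "inner (map_matrix cnj (transpose Z)) X = (\<Sum>i\<in>UNIV. \<Sum>j\<in>UNIV. inner (cnj (Z $ j $ i)) (X $ i $ j))"
      by (simp add: inner_vec_def transpose_def)
    also have "\<dots> = (\<Sum>j\<in>UNIV. \<Sum>i\<in>UNIV. inner (cnj (Z $ j $ i)) (cnj (X $ j $ i)))"
      using X by (subst sum.swap) (simp add: hermitian_iff_component)
    also have "\<dots> = inner Z X"
      by (simp add: inner_vec_def inner_complex_def)
    finally show ?thesis
      by (simp add: expect_eq_inner [OF herm]) (simp add: Y_def inner_add_left)
  qed
  have "psd Y"
    using herm ZP [OF psd_ketbra] YZ [OF psd_imp_hermitian [OF psd_ketbra]]
    by (simp add: psd_iff_hermitian expect_ketbra [symmetric])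
  have YL: "(1 + s) * expect Y \<tau> < b" "0 \<le> expect Y \<tau>" if "\<tau> \<in> L" for \<tau>
  proof -
    have "psd \<tau>" using Lst [OF that] by (simp add: is_state_def)
    then show "(1 + s) * expect Y \<tau> < b" "0 \<le> expect Y \<tau>"
      using Zb(1) [of "(1 + s) *\<^sub>R \<tau>"] that YZ [OF psd_imp_hermitian] ZP by auto
  qed
  have "psd 0" by (simp add: psd_def cinner_def)
  then have Y\<rho>: "b < expect Y \<rho>"
    using Zb(2) [OF imageI, of 0] YZ [OF psd_imp_hermitian, of \<rho>] \<rho> by (auto simp: is_state_def)
  \<comment> \<open>Any free state shows that the threshold \<open>b\<close> is positive, which
    permits division by it.\<close>
  obtain \<tau> where "\<tau> \<in> L" using L' by blast
  then have b: "0 < b"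
    using YL s by (metis add_nonneg_nonneg mult_nonneg_nonneg order_le_less_trans zero_le_one)
  \<comment> \<open>This factor turns the bound \<open>b\<close> on
    \<open>(1 + s) * expect Y \<tau>\<close> into 1, and the value at \<rho>, which exceeds
    \<open>b\<close>, into one exceeding \<open>1 + s\<close>.\<close>
  let ?Y = "((1 + s) / b) *\<^sub>R Y"
  have "robustness_witness L ?Y"
    using YL b s \<open>psd Y\<close>
    by (auto simp: robustness_witness_def expect_scaleR_left psd_scaleR less_imp_le)
  moreover have "s < expect ?Y \<rho> - 1"
    using Y\<rho> b s mult_strict_left_mono [OF Y\<rho>, of "1 + s"]
    by (simp add: expect_scaleR_left field_simps)
  ultimately show ?thesis by blast
qed

text \<open>By separation the optimal value exceeds every infeasible \<open>s\<close>. Since 0 is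
  infeasible for a resource state, the value is positive; since it cannot exceed itself, it is
  feasible and bounds the infimum.\<close>

lemma robustness_le_optimal_witness:
  assumes L: "free_states L" and \<rho>: "is_state \<rho>" "\<rho> \<notin> L" and Y: "optimal_witness L \<rho> Y"
  shows "0 < expect Y \<rho> - 1" "robustness L \<rho> \<le> ereal (expect Y \<rho> - 1)"
proof -
  let ?r = "expect Y \<rho> - 1"
  have max: "expect Y' \<rho> - 1 \<le> ?r" if "robustness_witness L Y'" for Y'
    using Y that by (auto simp: optimal_witness_def is_arg_max_linorder)
  have lt: "s < ?r" if "0 \<le> s" "\<nexists>\<gamma>. is_state \<gamma> \<and> (1 / (1 + s)) *\<^sub>R (\<rho> + s *\<^sub>R \<gamma>) \<in> L" for s
    using separating_witness [OF L \<rho>(1) that] max by fastforce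
  show pos: "0 < ?r" using \<rho>(2) by (intro lt) auto
  then have "\<exists>\<gamma>. is_state \<gamma> \<and> (1 / (1 + ?r)) *\<^sub>R (\<rho> + ?r *\<^sub>R \<gamma>) \<in> L"
    using lt [of ?r] by (meson less_imp_le less_irrefl)
  then show "robustness L \<rho> \<le> ereal ?r"
    unfolding robustness_def using pos by (intro INF_lower) auto
qed

subsection \<open>The implementation cost\<close>

text \<open>Positivity is complete positivity with a one-dimensional ancilla.\<close>

lemma quantum_channel_state:
  assumes "quantum_channel \<Phi>" "is_state \<rho>"
  shows "is_state (\<Phi> \<rho>)"
proof -
  have b: "block_psd 1 (\<lambda>i j. A) \<longleftrightarrow> psd A" for A :: "complex ^ 'n ^ 'n"
    by (auto simp: block_psd_def psd_def)
  have "block_psd 1 (\<lambda>i j. \<Phi> \<rho>)"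
    using assms b [of \<rho>] by (auto simp: quantum_channel_def completely_positive_def is_state_def)
  then show ?thesis
    using assms b [of "\<Phi> \<rho>"] by (simp add: quantum_channel_def is_state_def)
qed

text \<open>Stated with \<open>T\<close> in place of the inverse of \<beta>, so that
  \<open>T = 0\<close> covers zero temperature.\<close>

lemma eta_cost_le:
  assumes L: "free_states L" and \<sigma>: "\<sigma> \<in> L" "pure_state \<sigma>" and E: "quantum_channel \<E>"
    and out: "\<E> \<sigma> \<notin> L" and Y: "optimal_witness L (\<E> \<sigma>) Y"
    and T: "0 \<le> T" and lam: "0 < lam"
    and le: "ereal (T * entropy (\<E> \<sigma>)) / robustness L (\<E> \<sigma>) \<le> ereal lam"
  shows "eta_cost L T \<E> \<sigma> \<le> 1 / (robustness L (\<E> \<sigma>) - ereal (inverse lam * T * entropy (\<E> \<sigma>)))"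
proof -
  let ?\<rho> = "\<E> \<sigma>" and ?H = "lam *\<^sub>R Y"
  let ?S = "entropy ?\<rho>"
  have Lst: "\<And>\<tau>. \<tau> \<in> L \<Longrightarrow> is_state \<tau>"
    using L by (auto simp: free_states_def)
  have wit: "psd Y" "\<And>\<tau>. \<tau> \<in> L \<Longrightarrow> expect Y \<tau> \<le> 1"
    using Y by (auto simp: optimal_witness_def is_arg_max_def robustness_witness_def)
  define r where "r = expect Y ?\<rho> - 1"
  note dual = robustness_le_optimal_witness [OF L quantum_channel_state [OF E Lst [OF \<sigma>(1)]] out Y,
      folded r_def]
  have "0 \<le> robustness L ?\<rho>"
    unfolding robustness_def by (intro INF_greatest) auto
  then obtain R where R: "robustness L ?\<rho> = ereal R" "0 \<le> R" "R \<le> r"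
    using dual(2) by (cases "robustness L ?\<rho>") auto
  define d where "d = R - inverse lam * T * ?S"
  have rhs: "robustness L ?\<rho> - ereal (inverse lam * T * ?S) = ereal d"
    by (simp add: R d_def)
  have S: "0 \<le> ?S"
    using entropy_nonneg quantum_channel_state [OF E Lst [OF \<sigma>(1)]] by blast
  \<comment> \<open>In \<open>ereal\<close> a positive number divided by 0 is infinite, so for
    \<open>R = 0\<close> the hypothesis \<open>le\<close> forces \<open>T * ?S = 0\<close>.\<close>
  have "T * ?S \<le> lam * R"
  proof (cases "R = 0")
    case True
    then show ?thesis
      using le S T by (cases "T * ?S = 0") (auto simp: R divide_ereal_def zero_ereal_def[symmetric] split: if_splits)
  next
    case False
    then show ?thesis using le R by (simp add: field_simps)
  qed
  then have "0 \<le> d" using lam by (simp add: d_def field_simps)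
  show ?thesis
  proof (cases "d = 0")
    case True
    then show ?thesis unfolding rhs by (simp add: zero_ereal_def [symmetric] divide_ereal_def)
  next
    case False
    with \<open>0 \<le> d\<close> have d: "0 < d" by simp
    obtain v where v: "\<sigma> = ketbra v" using \<sigma>(2) by (auto simp: pure_state_def)
    define x where "x = 1 - expect Y \<sigma>"
    have x: "0 \<le> x" "x \<le> 1"
      using wit(2) [OF \<sigma>(1)] psd_Re_nonneg [OF wit(1)] by (auto simp: x_def v expect_ketbra)
    define D where "D = free_energy T ?H ?\<rho> - free_energy T ?H \<sigma>"
    \<comment> \<open>Purity of \<sigma> removes its entropy. Substituting \<open>d\<close> for the
      remaining entropy term and using \<open>R \<le> r\<close> yields the lower bound on
      \<open>D\<close>.\<close>
    have "D = lam * (x + r) - T * ?S"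
      by (simp add: D_def free_energy_def entropy_pure \<sigma> expect_scaleR_left x_def r_def algebra_simps)
    moreover have "T * ?S = lam * (R - d)"
      using lam by (simp add: d_def field_simps)
    moreover have "lam * R \<le> lam * r"
      using R(3) lam by (intro mult_left_mono) auto
    ultimately have D: "lam * (x + d) \<le> D"
      unfolding distrib_left right_diff_distrib by linarith
    have Dpos: "0 < D" using D x d lam by (smt (verit) mult_pos_pos)
    have "(free_energy T ?H (\<Omega> \<sigma>) - free_energy T ?H \<sigma>) / D \<le> 1 / d"
      if \<Omega>: "\<Omega> \<in> free_channels L" for \<Omega>
    proof -
      have \<Omega>L: "\<Omega> \<sigma> \<in> L" using \<Omega> \<sigma>(1) by (auto simp: free_channels_def)
      have "lam * expect Y (\<Omega> \<sigma>) \<le> lam * 1"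
        using wit(2) [OF \<Omega>L] lam by (intro mult_left_mono) auto
      moreover have "0 \<le> T * entropy (\<Omega> \<sigma>)"
        using entropy_nonneg [OF Lst [OF \<Omega>L]] T by simp
      ultimately have "free_energy T ?H (\<Omega> \<sigma>) - free_energy T ?H \<sigma> \<le> lam * x"
        by (simp add: free_energy_def entropy_pure \<sigma> expect_scaleR_left x_def algebra_simps)
      \<comment> \<open>With the positive denominators cleared, the claim is \<open>d\<close> times
        the numerator at most \<open>D\<close>. It follows from
        \<open>d * x \<le> d \<le> x + d\<close>, as \<open>x\<close> lies between 0 and 1.\<close>
      then have "d * (free_energy T ?H (\<Omega> \<sigma>) - free_energy T ?H \<sigma>) \<le> d * (lam * x)"
        using d by (intro mult_left_mono) auto
      also have "\<dots> \<le> lam * (x + d)"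
      proof -
        have "d * x \<le> x + d" using x d mult_left_le [of x d] by linarith
        then show ?thesis using lam by (simp add: mult.left_commute)
      qed
      also note D
      finally show ?thesis using d Dpos by (simp add: field_simps)
    qed
    then have "(SUP \<Omega> \<in> free_channels L. ereal ((free_energy T ?H (\<Omega> \<sigma>) - free_energy T ?H \<sigma>) / D))
        \<le> ereal (1 / d)"
      by (intro SUP_least) simp
    moreover have "psd ?H" using wit(1) lam by (simp add: psd_scaleR)
    ultimately have "eta_cost L T \<E> \<sigma> \<le> ereal (1 / d)"
      unfolding eta_cost_def using Dpos D_def by (intro INF_lower2 [of ?H]) auto
    then show ?thesis unfolding rhs using d by (simp add: one_ereal_def)
  qed
qed

theorem theorem3:
  fixes L :: "(complex ^ 'n ^ 'n) set"
    and \<sigma> :: "complex ^ 'n ^ 'n"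
    and \<E> :: "complex ^ 'n ^ 'n \<Rightarrow> complex ^ 'n ^ 'n"
    and \<beta> :: real
  assumes "free_states L"
    and "\<sigma> \<in> L" and "pure_state \<sigma>"
    and "quantum_channel \<E>"
    and "\<E> \<sigma> \<notin> L"
    and "\<exists>Y. optimal_witness L (\<E> \<sigma>) Y"
    and "0 < \<beta>"
  shows "(\<forall>lam::real. 0 < lam \<and> ereal (inverse \<beta> * entropy (\<E> \<sigma>)) / robustness L (\<E> \<sigma>) \<le> ereal lam \<longrightarrow>
            eta_cost L (inverse \<beta>) \<E> \<sigma>
              \<le> 1 / (robustness L (\<E> \<sigma>) - ereal (inverse lam * inverse \<beta> * entropy (\<E> \<sigma>)))) \<and>
         (entropy (\<E> \<sigma>) = 0 \<longrightarrow> eta_cost L (inverse \<beta>) \<E> \<sigma> \<le> 1 / robustness L (\<E> \<sigma>)) \<and>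
         eta_cost L 0 \<E> \<sigma> \<le> 1 / robustness L (\<E> \<sigma>)"
proof -
  obtain Y where Y: "optimal_witness L (\<E> \<sigma>) Y" using assms(6) by blast
  note bound = eta_cost_le [OF assms(1-5) Y]
  \<comment> \<open>When \<open>T * entropy (\<E> \<sigma>)\<close> vanishes, any positive parameter
    is admissible and the correction term is 0; the value 1 is chosen.\<close>
  have zero: "eta_cost L T \<E> \<sigma> \<le> 1 / robustness L (\<E> \<sigma>)" if "0 \<le> T" "T * entropy (\<E> \<sigma>) = 0" for T
    using bound [of T 1] that by (simp add: zero_ereal_def [symmetric] divide_ereal_def)
  show ?thesis
    using bound [of "inverse \<beta>"] zero [of 0] zero [of "inverse \<beta>"] assms(7) by auto
qed

end
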